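(* Let $(\Omega,\mathcal{F},\mathbb{P})$ be a probability space, let $\mathcal{A}\subset L^\infty$ be an acceptance set and let $S=(S_0,S_1)$ be an eligible asset. Assume that $\mathcal{A}$ is convex and $\rho_{\mathcal{A}}$ is comonotonic. Then the following statements are equivalent: (a) $\rho_{\mathcal{A},S}$ is comonotonic. (b) Both $1+\tfrac{\rho_{\mathcal{A},S}(1)}{S_0}S_1$ and $-\big(1+\tfrac{\rho_{\mathcal{A},S}(1)}{S_0}S_1\big)$ belong to $\mathcal{A}$. (c) $S_1+\tfrac{S_0}{\rho_{\mathcal{A},S}(1)}\in\mathcal{A}\cap(-\mathcal{A})$.
   Context: $L^\infty=L^\infty(\Omega,\mathcal{F},\mathbb{P})$ is the space of (a.s.-equivalence classes of) essentially bounded real random variables, with the essential supremum norm $\|\cdot\|$ and the almost sure order; $L^\infty_+=\{X\in L^\infty : X\ge 0\}$. Constants are identified with constant random variables. An acceptance set is a nonempty proper subset $\mathcal{A}\subset L^\infty$ that is norm-closed and increasing, i.e. $\mathcal{A}+L^\infty_+\subset\mathcal{A}$. An eligible asset is a pair $S=(S_0,S_1)\in(0,\infty)\times L^\infty_+$ with $S_1\ge\varepsilon$ a.s. for some constant $\varepsilon>0$. The associated risk measure is $\rho_{\mathcal{A},S}:L^\infty\to\mathbb{R}$, $\rho_{\mathcal{A},S}(X)=\inf\{m\in\mathbb{R} : X+\tfrac{m}{S_0}S_1\in\mathcal{A}\}$ (finitely valued under these assumptions), and $\rho_{\mathcal{A}}(X)=\inf\{m\in\mathbb{R} : X+m\in\mathcal{A}\}$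 (the case $S=(1,1)$). Two random variables $X,Y\in L^\infty$ are comonotone if there is a $\mathbb{P}\otimes\mathbb{P}$-null set $N$ such that $(X(\omega)-X(\omega'))(Y(\omega)-Y(\omega'))\ge0$ for all $(\omega,\omega')\in(\Omega\times\Omega)\setminus N$. A functional $\rho:L^\infty\to\mathbb{R}$ is comonotonic if $\rho(X+Y)=\rho(X)+\rho(Y)$ for all comonotone $X,Y\in L^\infty$. *)

theory Defs
  imports "HOL-Probability.Probability"
begin

text \<open>
  Elements of $L^\infty$ are represented by measurable functions rather than by classes modulo
  a.s. equality; functions are compared only almost surely.  Sets \<open>A\<close> of functions stand for
  sets of classes when they are saturated with respect to a.s. equality; for acceptance sets this
  follows from monotonicity, see \<open>acceptance_set_AE_cong\<close> below.
\<close>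

definition Linf :: "'a measure \<Rightarrow> ('a \<Rightarrow> real) set" where
  "Linf M = {X \<in> borel_measurable M. esssup M (\<lambda>\<omega>. ereal \<bar>X \<omega>\<bar>) < \<infinity>}"

definition Linf_norm :: "'a measure \<Rightarrow> ('a \<Rightarrow> real) \<Rightarrow> real" where
  "Linf_norm M X = real_of_ereal (esssup M (\<lambda>\<omega>. ereal \<bar>X \<omega>\<bar>))"

definition Linf_plus :: "'a measure \<Rightarrow> ('a \<Rightarrow> real) set" where
  "Linf_plus M = {X \<in> Linf M. AE \<omega> in M. 0 \<le> X \<omega>}"

definition Linf_closed :: "'a measure \<Rightarrow> ('a \<Rightarrow> real) set \<Rightarrow> bool" where
  "Linf_closed M A \<longleftrightarrow>
     (\<forall>X \<in> Linf M. (\<forall>e>0. \<exists>Y\<in>A. Linf_norm M (\<lambda>\<omega>. Y \<omega> - X \<omega>) < e) \<longrightarrow> X \<in> A)"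

definition acceptance_set :: "'a measure \<Rightarrow> ('a \<Rightarrow> real) set \<Rightarrow> bool" where
  "acceptance_set M A \<longleftrightarrow>
     A \<noteq> {} \<and> A \<subset> Linf M \<and> Linf_closed M A \<and>
     (\<forall>X\<in>A. \<forall>Z\<in>Linf_plus M. (\<lambda>\<omega>. X \<omega> + Z \<omega>) \<in> A)"

definition eligible_asset :: "'a measure \<Rightarrow> real \<Rightarrow> ('a \<Rightarrow> real) \<Rightarrow> bool" where
  "eligible_asset M S0 S1 \<longleftrightarrow>
     0 < S0 \<and> S1 \<in> Linf_plus M \<and> (\<exists>\<epsilon>>0. AE \<omega> in M. \<epsilon> \<le> S1 \<omega>)"

text \<open>
  The library's \<open>convex\<close> requires a real vector space type, which \<open>'a \<Rightarrow> real\<close> is not.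
\<close>

definition convex_rv :: "('a \<Rightarrow> real) set \<Rightarrow> bool" where
  "convex_rv A \<longleftrightarrow>
     (\<forall>X\<in>A. \<forall>Y\<in>A. \<forall>u\<ge>0. \<forall>v\<ge>0. u + v = 1 \<longrightarrow> (\<lambda>\<omega>. u * X \<omega> + v * Y \<omega>) \<in> A)"

definition risk_measure ::
  "('a \<Rightarrow> real) set \<Rightarrow> real \<Rightarrow> ('a \<Rightarrow> real) \<Rightarrow> ('a \<Rightarrow> real) \<Rightarrow> real" where
  "risk_measure A S0 S1 X = Inf {m::real. (\<lambda>\<omega>. X \<omega> + m / S0 * S1 \<omega>) \<in> A}"

definition cash_risk_measure :: "('a \<Rightarrow> real) set \<Rightarrow> ('a \<Rightarrow> real) \<Rightarrow> real" where
  "cash_risk_measure A X = Inf {m::real. (\<lambda>\<omega>. X \<omega> + m) \<in> A}"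

definition comonotone :: "'a measure \<Rightarrow> ('a \<Rightarrow> real) \<Rightarrow> ('a \<Rightarrow> real) \<Rightarrow> bool" where
  "comonotone M X Y \<longleftrightarrow>
     (\<exists>N \<in> null_sets (M \<Otimes>\<^sub>M M). \<forall>(\<omega>, \<omega>') \<in> space M \<times> space M - N.
        0 \<le> (X \<omega> - X \<omega>') * (Y \<omega> - Y \<omega>'))"

definition comonotonic :: "'a measure \<Rightarrow> (('a \<Rightarrow> real) \<Rightarrow> real) \<Rightarrow> bool" where
  "comonotonic M \<rho> \<longleftrightarrow>
     (\<forall>X \<in> Linf M. \<forall>Y \<in> Linf M. comonotone M X Y \<longrightarrow>
        \<rho> (\<lambda>\<omega>. X \<omega> + Y \<omega>) = \<rho> X + \<rho> Y)"

lemma cash_risk_measure_eq: "cash_risk_measure A = risk_measure A 1 (\<lambda>_. 1)"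
  by (simp add: fun_eq_iff cash_risk_measure_def risk_measure_def)

lemma Linf_AE_iff:
  "X \<in> Linf M \<longleftrightarrow> X \<in> borel_measurable M \<and> (\<exists>C::real. AE \<omega> in M. \<bar>X \<omega>\<bar> \<le> C)"
proof (cases "X \<in> borel_measurable M")
  case True
  then have meas: "(\<lambda>\<omega>. ereal \<bar>X \<omega>\<bar>) \<in> borel_measurable M"
    by measurable
  have "esssup M (\<lambda>\<omega>. ereal \<bar>X \<omega>\<bar>) < \<infinity> \<longleftrightarrow> (\<exists>C::real. AE \<omega> in M. \<bar>X \<omega>\<bar> \<le> C)"
  proof
    assume "esssup M (\<lambda>\<omega>. ereal \<bar>X \<omega>\<bar>) < \<infinity>"
    then obtain C :: real where C: "esssup M (\<lambda>\<omega>. ereal \<bar>X \<omega>\<bar>) \<le> ereal C"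
      by (cases "esssup M (\<lambda>\<omega>. ereal \<bar>X \<omega>\<bar>)") auto
    have "AE \<omega> in M. ereal \<bar>X \<omega>\<bar> \<le> esssup M (\<lambda>\<omega>. ereal \<bar>X \<omega>\<bar>)"
      by (rule esssup_AE)
    then have "AE \<omega> in M. \<bar>X \<omega>\<bar> \<le> C"
    proof eventually_elim
      case (elim \<omega>)
      from order_trans[OF elim C] show ?case by simp
    qed
    then show "\<exists>C::real. AE \<omega> in M. \<bar>X \<omega>\<bar> \<le> C" ..
  next
    assume "\<exists>C::real. AE \<omega> in M. \<bar>X \<omega>\<bar> \<le> C"
    then obtain C :: real where "AE \<omega> in M. \<bar>X \<omega>\<bar> \<le> C" ..
    then have "esssup M (\<lambda>\<omega>. ereal \<bar>X \<omega>\<bar>) \<le> ereal C"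
      by (intro esssup_I meas) simp
    then show "esssup M (\<lambda>\<omega>. ereal \<bar>X \<omega>\<bar>) < \<infinity>"
      by (rule le_less_trans) simp
  qed
  with True show ?thesis by (simp add: Linf_def)
qed (simp add: Linf_def)

lemma acceptance_set_AE_cong:
  assumes A: "acceptance_set M A" and X: "X \<in> A"
    and Y: "Y \<in> borel_measurable M" and eq: "AE \<omega> in M. X \<omega> = Y \<omega>"
  shows "Y \<in> A"
proof -
  define Z where "Z = (\<lambda>\<omega>. Y \<omega> - X \<omega>)"
  have "X \<in> Linf M"
    using A X by (meson acceptance_set_def psubset_imp_subset subsetD)
  then have "X \<in> borel_measurable M"
    by (simp add: Linf_def)
  then have Z_meas: "Z \<in> borel_measurable M"
    using Y by (simp add: Z_def)
  have Z_bound: "AE \<omega> in M. \<bar>Z \<omega>\<bar> \<le> 0"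
    using eq unfolding Z_def by eventually_elim simp
  have Z_nonneg: "AE \<omega> in M. 0 \<le> Z \<omega>"
    using eq unfolding Z_def by eventually_elim simp
  have "Z \<in> Linf M"
    unfolding Linf_AE_iff using Z_meas Z_bound by (intro conjI exI[of _ 0])
  then have Z_plus: "Z \<in> Linf_plus M"
    using Z_nonneg by (simp add: Linf_plus_def)
  have incr: "\<forall>X\<in>A. \<forall>Z\<in>Linf_plus M. (\<lambda>\<omega>. X \<omega> + Z \<omega>) \<in> A"
    using A by (simp add: acceptance_set_def)
  have "(\<lambda>\<omega>. X \<omega> + Z \<omega>) \<in> A"
    by (rule bspec[OF bspec[OF incr X] Z_plus])
  then show ?thesis by (simp add: Z_def)
qed

end

theory Submission
  imports Defs
begin

text \<open>
  Comonotonicity of \<open>\<rho>\<^sub>A\<close> gives \<open>\<rho>\<^sub>A(0) = 0\<close> and \<open>\<rho>\<^sub>A(2X) = 2\<rho>\<^sub>A(X)\<close>, so the convex set \<open>A\<close> is a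
  convex cone.  Put \<open>c = \<rho>\<^sub>A\<^sub>,\<^sub>S(1) < 0\<close> and \<open>U = 1 + (c/S\<^sub>0) S\<^sub>1\<close>; closedness gives \<open>U \<in> A\<close>.
  If \<open>\<rho>\<^sub>A\<^sub>,\<^sub>S\<close> is comonotonic, it is additive on \<open>1\<close> and \<open>-1\<close>, so \<open>\<rho>\<^sub>A\<^sub>,\<^sub>S(-1) = -c\<close> and \<open>-U \<in> A\<close>.
  Conversely, if \<open>U\<close> lies in the lineality space \<open>A \<inter> -A\<close>, then membership in \<open>A\<close> is invariant under
  adding multiples of \<open>U\<close>; hence \<open>X + (m/S\<^sub>0) S\<^sub>1 \<in> A\<close> iff \<open>X - m/c \<in> A\<close>, so
  \<open>\<rho>\<^sub>A\<^sub>,\<^sub>S = -c \<rho>\<^sub>A\<close> inherits comonotonicity.  Finally, (b) and (c) differ only by scaling \<open>U\<close>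
  with the negative factor \<open>S\<^sub>0/c\<close>.
\<close>

section \<open>Linear structure and norm bounds of essentially bounded functions\<close>

lemma Linf_const: "(\<lambda>_. c) \<in> Linf M"
  unfolding Linf_AE_iff by auto

lemma Linf_add:
  assumes "X \<in> Linf M" "Y \<in> Linf M"
  shows "(\<lambda>\<omega>. X \<omega> + Y \<omega>) \<in> Linf M"
proof -
  obtain B C where B: "AE \<omega> in M. \<bar>X \<omega>\<bar> \<le> B" and C: "AE \<omega> in M. \<bar>Y \<omega>\<bar> \<le> C"
    using assms unfolding Linf_AE_iff by blast
  have "AE \<omega> in M. \<bar>X \<omega> + Y \<omega>\<bar> \<le> B + C"
    using B C by eventually_elim linarith
  then show ?thesis
    using assms unfolding Linf_AE_iff by auto
qed

lemma Linf_scale: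
  assumes "X \<in> Linf M"
  shows "(\<lambda>\<omega>. a * X \<omega>) \<in> Linf M"
proof -
  obtain B where B: "AE \<omega> in M. \<bar>X \<omega>\<bar> \<le> B"
    using assms unfolding Linf_AE_iff by blast
  have "AE \<omega> in M. \<bar>a * X \<omega>\<bar> \<le> \<bar>a\<bar> * B"
    using B by eventually_elim (simp add: abs_mult mult_left_mono)
  then show ?thesis
    using assms unfolding Linf_AE_iff by auto
qed

text \<open>The assumption \<open>0 \<le> C\<close> covers the null measure: there the essential
  supremum is minus infinity, which \<open>real_of_ereal\<close> sends to 0.\<close>

lemma Linf_norm_le:
  assumes "X \<in> borel_measurable M" "AE \<omega> in M. \<bar>X \<omega>\<bar> \<le> C" "0 \<le> C"
  shows "Linf_norm M X \<le> C"
proof -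
  have "esssup M (\<lambda>\<omega>. ereal \<bar>X \<omega>\<bar>) \<le> ereal C"
    using assms by (intro esssup_I) auto
  then show ?thesis
    unfolding Linf_norm_def using assms(3)
    by (cases "esssup M (\<lambda>\<omega>. ereal \<bar>X \<omega>\<bar>)") auto
qed

section \<open>Acceptance sets and sublevel sets of risk measures\<close>

lemma acceptance_set_subset: "acceptance_set M A \<Longrightarrow> A \<subseteq> Linf M"
  by (simp add: acceptance_set_def psubset_imp_subset)

lemma acceptance_set_mono:
  assumes A: "acceptance_set M A" and X: "X \<in> A" and Y: "Y \<in> Linf M"
    and le: "AE \<omega> in M. X \<omega> \<le> Y \<omega>"
  shows "Y \<in> A"
proof -
  have "X \<in> Linf M"
    using acceptance_set_subset[OF A] X by blast
  then have "(\<lambda>\<omega>. Y \<omega> + - 1 * X \<omega>) \<in> Linf M"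
    by (intro Linf_add Linf_scale Y)
  then have Z: "(\<lambda>\<omega>. Y \<omega> - X \<omega>) \<in> Linf_plus M"
    using le by (simp add: Linf_plus_def)
  have "\<forall>X\<in>A. \<forall>Z\<in>Linf_plus M. (\<lambda>\<omega>. X \<omega> + Z \<omega>) \<in> A"
    using A by (simp add: acceptance_set_def)
  from bspec[OF bspec[OF this X] Z] have "(\<lambda>\<omega>. X \<omega> + (Y \<omega> - X \<omega>)) \<in> A" .
  then show ?thesis by simp
qed

lemma eligible_asset_unit: "eligible_asset M 1 (\<lambda>_. 1)"
  unfolding eligible_asset_def Linf_plus_def
  by (auto intro!: Linf_const exI[of _ 1])

text \<open>The admissible amounts \<open>D\<close> form a nonempty, upward closed set that is
  bounded below, and norm-closedness of \<open>A\<close> puts the infimum into \<open>D\<close>. So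
  \<open>D\<close> is a closed half-line, and inequalities for the risk measure become membership in
  \<open>A\<close>.\<close>

lemma risk_measure_le_iff:
  assumes A: "acceptance_set M A" and S: "eligible_asset M S0 S1" and X: "X \<in> Linf M"
  shows "risk_measure A S0 S1 X \<le> m \<longleftrightarrow> (\<lambda>\<omega>. X \<omega> + m / S0 * S1 \<omega>) \<in> A"
proof -
  define V where "V = (\<lambda>m \<omega>. X \<omega> + m / S0 * S1 \<omega>)"
  define D where "D = {m. V m \<in> A}"
  from S obtain e where S0: "0 < S0" and S1: "S1 \<in> Linf M"
    and e: "0 < e" "AE \<omega> in M. e \<le> S1 \<omega>"
    by (auto simp: eligible_asset_def Linf_plus_def)
  obtain K where K: "AE \<omega> in M. \<bar>S1 \<omega>\<bar> \<le> K"
    using S1 unfolding Linf_AE_iff by blast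
  obtain B where B: "AE \<omega> in M. \<bar>X \<omega>\<bar> \<le> B"
    using X unfolding Linf_AE_iff by blast
  have V: "V m \<in> Linf M" for m
    unfolding V_def by (intro Linf_add Linf_scale X S1)
  have up: "m' \<in> D" if "m \<in> D" "m \<le> m'" for m m'
  proof -
    have "AE \<omega> in M. V m \<omega> \<le> V m' \<omega>"
      using e(2)
    proof eventually_elim
      case (elim \<omega>)
      then show ?case
        unfolding V_def using S0 e(1) that(2)
        by (intro add_left_mono mult_right_mono divide_right_mono) auto
    qed
    then show ?thesis
      using acceptance_set_mono[OF A _ V] that(1) unfolding D_def by auto
  qed
  have "D \<noteq> {}"
  proof -
    obtain Y where Y: "Y \<in> A" "Y \<in> Linf M"
      using A acceptance_set_subset[OF A] unfolding acceptance_set_def by fast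
    obtain C where C: "AE \<omega> in M. \<bar>Y \<omega>\<bar> \<le> C"
      using Y(2) unfolding Linf_AE_iff by blast
    \<comment> \<open>Since \<open>S1\<close> is at least \<open>e\<close>, holding \<open>q\<close>
      units of it adds at least \<open>\<bar>B\<bar> + \<bar>C\<bar>\<close>, enough to lift
      \<open>X\<close> above the acceptable \<open>Y\<close>.\<close>
    define q where "q = (\<bar>B\<bar> + \<bar>C\<bar>) / e"
    have q: "q \<ge> 0" "q * e = \<bar>B\<bar> + \<bar>C\<bar>"
      using e(1) by (auto simp: q_def)
    have "AE \<omega> in M. Y \<omega> \<le> V (S0 * q) \<omega>"
      using B C e(2)
    proof eventually_elim
      case (elim \<omega>)
      have "q * e \<le> q * S1 \<omega>"
        using elim(3) q(1) by (rule mult_left_mono)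
      then show ?case
        using elim q(2) S0 by (simp add: V_def)
    qed
    then have "V (S0 * q) \<in> A"
      using acceptance_set_mono[OF A Y(1) V] by blast
    then show ?thesis unfolding D_def by blast
  qed
  have "bdd_below D"
  proof -
    \<comment> \<open>Mirror image of the previous step: selling \<open>q\<close> units pushes
      \<open>X\<close> below an unacceptable \<open>Z\<close>, and upward closure of
      \<open>D\<close> then excludes all smaller amounts as well.\<close>
    obtain Z where Z: "Z \<in> Linf M" "Z \<notin> A"
      using A unfolding acceptance_set_def by (meson psubset_imp_ex_mem DiffD1 DiffD2)
    obtain C where C: "AE \<omega> in M. \<bar>Z \<omega>\<bar> \<le> C"
      using Z(1) unfolding Linf_AE_iff by blast
    define q where "q = (\<bar>B\<bar> + \<bar>C\<bar>) / e"
    have q: "q \<ge> 0" "q * e = \<bar>B\<bar> + \<bar>C\<bar>"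
      using e(1) by (auto simp: q_def)
    have "AE \<omega> in M. V (- S0 * q) \<omega> \<le> Z \<omega>"
      using B C e(2)
    proof eventually_elim
      case (elim \<omega>)
      have "q * e \<le> q * S1 \<omega>"
        using elim(3) q(1) by (rule mult_left_mono)
      then show ?case
        using elim q(2) S0 by (simp add: V_def)
    qed
    then have "- S0 * q \<notin> D"
      using acceptance_set_mono[OF A _ Z(1)] Z(2) unfolding D_def by blast
    then have "- S0 * q \<le> m" if "m \<in> D" for m
      using up[OF that, of "- S0 * q"] by linarith
    then show ?thesis by (rule bdd_belowI)
  qed
  have "Inf D \<in> D"
  proof -
    have "\<exists>Y\<in>A. Linf_norm M (\<lambda>\<omega>. Y \<omega> - V (Inf D) \<omega>) < d" if "d > 0" for d
    proof -
      \<comment> \<open>Chosen so that \<open>t / S0 * (\<bar>K\<bar> + 1)\<close> is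
        \<open>d / 2\<close>; the added 1 keeps the denominator positive.\<close>
      define t where "t = d * S0 / (2 * (\<bar>K\<bar> + 1))"
      have t: "t > 0" using that S0 by (simp add: t_def)
      then obtain m where m: "m \<in> D" "m < Inf D + t"
        using cInf_lessD[of D "Inf D + t"] \<open>D \<noteq> {}\<close> by auto
      have Vt: "V (Inf D + t) \<in> A"
        using up[OF m(1)] m(2) by (auto simp: D_def)
      have diff: "V (Inf D + t) \<omega> - V (Inf D) \<omega> = t / S0 * S1 \<omega>" for \<omega>
        using S0 by (simp add: V_def field_simps)
      have "Linf_norm M (\<lambda>\<omega>. t / S0 * S1 \<omega>) \<le> t / S0 * (\<bar>K\<bar> + 1)"
      proof (rule Linf_norm_le)
        show "(\<lambda>\<omega>. t / S0 * S1 \<omega>) \<in> borel_measurable M"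
          using Linf_scale[OF S1] unfolding Linf_AE_iff by blast
        show "AE \<omega> in M. \<bar>t / S0 * S1 \<omega>\<bar> \<le> t / S0 * (\<bar>K\<bar> + 1)"
          using K
        proof eventually_elim
          case (elim \<omega>)
          have "t / S0 * \<bar>S1 \<omega>\<bar> \<le> t / S0 * (\<bar>K\<bar> + 1)"
            using elim S0 t by (intro mult_left_mono) auto
          then show ?case
            using S0 t by (simp add: abs_mult)
        qed
      qed (use S0 t in auto)
      also have "t / S0 * (\<bar>K\<bar> + 1) = d / 2"
        using S0 by (simp add: t_def divide_simps add_nonneg_eq_0_iff)
      also have "\<dots> < d" using that by simp
      finally show ?thesis
        using Vt by (intro bexI[of _ "V (Inf D + t)"]) (simp_all add: diff)
    qed
    moreover have "Linf_closed M A"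
      using A by (simp add: acceptance_set_def)
    ultimately show ?thesis
      using V unfolding Linf_closed_def D_def by blast
  qed
  then have "Inf D \<le> m \<longleftrightarrow> m \<in> D"
    using up[of "Inf D" m] cInf_lower[OF _ \<open>bdd_below D\<close>, of m] by blast
  then show ?thesis
    by (simp add: risk_measure_def D_def V_def)
qed

lemma cash_risk_measure_le_iff:
  assumes "acceptance_set M A" "X \<in> Linf M"
  shows "cash_risk_measure A X \<le> m \<longleftrightarrow> (\<lambda>\<omega>. X \<omega> + m) \<in> A"
  using risk_measure_le_iff[OF assms(1) eligible_asset_unit assms(2)]
  by (simp add: cash_risk_measure_eq)

section \<open>Comonotonic functionals and the cone property\<close>

lemma comonotoneI:
  assumes "\<And>\<omega> \<omega>'. 0 \<le> (X \<omega> - X \<omega>') * (Y \<omega> - Y \<omega>')"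
  shows "comonotone M X Y"
  unfolding comonotone_def using assms by (intro bexI[of _ "{}"]) auto

lemma comonotonic_add:
  assumes "comonotonic M \<rho>" "X \<in> Linf M" "Y \<in> Linf M" "comonotone M X Y"
  shows "\<rho> (\<lambda>\<omega>. X \<omega> + Y \<omega>) = \<rho> X + \<rho> Y"
  using assms unfolding comonotonic_def by blast

lemma comonotonic_zero:
  assumes "comonotonic M \<rho>"
  shows "\<rho> (\<lambda>_. 0) = 0"
  using comonotonic_add[OF assms Linf_const Linf_const comonotoneI, of 0 0] by simp

lemma comonotonic_scale:
  assumes "comonotonic M \<rho>" "\<And>X. X \<in> Linf M \<Longrightarrow> \<rho>' X = a * \<rho> X"
  shows "comonotonic M \<rho>'"
  using assms unfolding comonotonic_def by (simp add: Linf_add distrib_left)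

lemma zero_in_comonotonic_acceptance_set:
  assumes "acceptance_set M A" "comonotonic M (cash_risk_measure A)"
  shows "(\<lambda>_. 0) \<in> A"
  using cash_risk_measure_le_iff[OF assms(1) Linf_const, of 0 0] comonotonic_zero[OF assms(2)]
  by simp

text \<open>Any function is comonotone with itself, so \<open>A\<close> is closed under doubling and
  hence under factors \<open>2 ^ n\<close>. A convex combination with 0 then shrinks
  \<open>2 ^ n * X\<close> to the required multiple.\<close>

lemma comonotonic_acceptance_set_scale:
  assumes A: "acceptance_set M A" and com: "comonotonic M (cash_risk_measure A)"
    and conv: "convex_rv A" and X: "X \<in> A" and t: "0 \<le> t"
  shows "(\<lambda>\<omega>. t * X \<omega>) \<in> A"
proof -
  have double: "(\<lambda>\<omega>. 2 * Y \<omega>) \<in> A" if "Y \<in> A" for Y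
  proof -
    have Y: "Y \<in> Linf M" using acceptance_set_subset[OF A] that by blast
    have "cash_risk_measure A (\<lambda>\<omega>. Y \<omega> + Y \<omega>) = cash_risk_measure A Y + cash_risk_measure A Y"
      by (intro comonotonic_add[OF com] Y comonotoneI zero_le_square)
    moreover have "cash_risk_measure A Y \<le> 0"
      using cash_risk_measure_le_iff[OF A Y, of 0] that by simp
    ultimately show ?thesis
      using cash_risk_measure_le_iff[OF A Linf_add[OF Y Y], of 0] by simp
  qed
  have pow: "(\<lambda>\<omega>. 2 ^ n * X \<omega>) \<in> A" for n :: nat
  proof (induction n)
    case (Suc n)
    then show ?case using double[OF Suc] by (simp add: mult.assoc)
  qed (simp add: X)
  obtain n :: nat where n: "t < 2 ^ n"
    using real_arch_pow[of 2 t] by auto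
  define u where "u = t / 2 ^ n"
  have u: "0 \<le> u" "0 \<le> 1 - u" "u + (1 - u) = 1"
    using n t by (auto simp: u_def)
  have "(\<lambda>\<omega>. u * (2 ^ n * X \<omega>) + (1 - u) * 0) \<in> A"
    using conv[unfolded convex_rv_def, rule_format,
        OF pow[of n] zero_in_comonotonic_acceptance_set[OF A com] u] .
  then show ?thesis by (simp add: u_def)
qed

text \<open>The sum is twice the midpoint, which convexity places in \<open>A\<close>.\<close>

lemma comonotonic_acceptance_set_add:
  assumes A: "acceptance_set M A" and com: "comonotonic M (cash_risk_measure A)"
    and conv: "convex_rv A" and X: "X \<in> A" and Y: "Y \<in> A"
  shows "(\<lambda>\<omega>. X \<omega> + Y \<omega>) \<in> A"
proof -
  have "(\<lambda>\<omega>. 1/2 * X \<omega> + 1/2 * Y \<omega>) \<in> A"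
    using conv[unfolded convex_rv_def, rule_format, OF X Y, of "1/2" "1/2"] by simp
  from comonotonic_acceptance_set_scale[OF A com conv this, of 2]
  show ?thesis by simp
qed

theorem corollary2p19:
  fixes M :: "'a measure" and A :: "('a \<Rightarrow> real) set"
    and S0 :: real and S1 :: "'a \<Rightarrow> real"
  assumes "prob_space M"
    and "acceptance_set M A"
    and "eligible_asset M S0 S1"
    and "convex_rv A"
    and "comonotonic M (cash_risk_measure A)"
  shows "(comonotonic M (risk_measure A S0 S1) \<longleftrightarrow>
           (\<lambda>\<omega>. 1 + risk_measure A S0 S1 (\<lambda>_. 1) / S0 * S1 \<omega>) \<in> A \<and>
           (\<lambda>\<omega>. - (1 + risk_measure A S0 S1 (\<lambda>_. 1) / S0 * S1 \<omega>)) \<in> A) \<and>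
         (comonotonic M (risk_measure A S0 S1) \<longleftrightarrow>
           (\<lambda>\<omega>. S1 \<omega> + S0 / risk_measure A S0 S1 (\<lambda>_. 1)) \<in> A \<inter> (\<lambda>X \<omega>. - X \<omega>) ` A)"
proof -
  note scale = comonotonic_acceptance_set_scale[OF assms(2,5,4)]
  note add = comonotonic_acceptance_set_add[OF assms(2,5,4)]
  note le_iff = risk_measure_le_iff[OF assms(2,3)]
  define \<rho> where "\<rho> = risk_measure A S0 S1"
  define c where "c = \<rho> (\<lambda>_. 1)"
  define U where "U = (\<lambda>\<omega>. 1 + c / S0 * S1 \<omega>)"
  have S0: "0 < S0" and S1: "S1 \<in> Linf M"
    using assms(3) by (auto simp: eligible_asset_def Linf_plus_def)
  \<comment> \<open>The trivial inequality \<open>c \<le> c\<close> says that the infimum defining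
    \<open>c\<close> is attained.\<close>
  have U: "U \<in> A"
    using le_iff[OF Linf_const, of 1 c] by (simp add: U_def c_def \<rho>_def)
  have c: "c < 0"
  proof -
    obtain K where K: "AE \<omega> in M. \<bar>S1 \<omega>\<bar> \<le> K"
      using S1 unfolding Linf_AE_iff by blast
    \<comment> \<open>With \<open>S1\<close> bounded by \<open>\<bar>K\<bar> + 1\<close>, this
      negative amount keeps the position above 0, which lies in \<open>A\<close>; hence
      \<open>c \<le> m\<close>.\<close>
    define m where "m = - S0 / (\<bar>K\<bar> + 1)"
    have m: "m < 0" "m / S0 = - 1 / (\<bar>K\<bar> + 1)"
      using S0 by (auto simp: m_def divide_neg_pos)
    have "AE \<omega> in M. 0 \<le> 1 + m / S0 * S1 \<omega>"
      using K
    proof eventually_elim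
      case (elim \<omega>)
      then have "S1 \<omega> \<le> \<bar>K\<bar> + 1" by linarith
      then show ?case unfolding m(2) by (simp add: divide_simps)
    qed
    then have "(\<lambda>\<omega>. 1 + m / S0 * S1 \<omega>) \<in> A"
      by (rule acceptance_set_mono[OF assms(2)
            zero_in_comonotonic_acceptance_set[OF assms(2,5)]
            Linf_add[OF Linf_const Linf_scale[OF S1]]])
    then have "c \<le> m"
      using le_iff[OF Linf_const] by (simp add: c_def \<rho>_def)
    then show ?thesis using m(1) by simp
  qed
  have neg_U: "(\<lambda>\<omega>. - U \<omega>) \<in> A" if "comonotonic M \<rho>"
  proof -
    have "\<rho> (\<lambda>_. 1) + \<rho> (\<lambda>_. - 1) = 0"
      using comonotonic_add[OF that Linf_const Linf_const comonotoneI, of 1 "- 1"]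
        comonotonic_zero[OF that] by simp
    then have "\<rho> (\<lambda>_. - 1) \<le> - c" by (simp add: c_def)
    then have "(\<lambda>\<omega>. - 1 + - c / S0 * S1 \<omega>) \<in> A"
      using le_iff[OF Linf_const] by (simp add: \<rho>_def)
    then show ?thesis by (simp add: U_def)
  qed
  have com: "comonotonic M \<rho>" if nU: "(\<lambda>\<omega>. - U \<omega>) \<in> A"
  proof (rule comonotonic_scale[OF assms(5), of _ "- c"])
    fix X assume X: "X \<in> Linf M"
    \<comment> \<open>The cone property allows nonnegative factors; for negative \<open>t\<close>,
      apply it to \<open>- U\<close> with factor \<open>- t\<close>.\<close>
    have tU: "(\<lambda>\<omega>. t * U \<omega>) \<in> A" for t
      using scale[OF U, of t] scale[OF nU, of "- t"] by (cases "0 \<le> t") auto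
    have split: "m / c * U \<omega> = m / c + m / S0 * S1 \<omega>" for m \<omega>
      using c S0 by (simp add: U_def field_simps)
    \<comment> \<open>Two reals with the same upper bounds are equal. By \<open>split\<close>,
      adding or subtracting \<open>m / c * U\<close> exchanges the asset payoff
      \<open>m / S0 * S1\<close> for the cash amount \<open>- (m / c)\<close>.\<close>
    have "\<rho> X \<le> m \<longleftrightarrow> - c * cash_risk_measure A X \<le> m" for m
    proof -
      have "\<rho> X \<le> m \<longleftrightarrow> (\<lambda>\<omega>. X \<omega> + m / S0 * S1 \<omega>) \<in> A"
        using le_iff[OF X] by (simp add: \<rho>_def)
      also have "\<dots> \<longleftrightarrow> (\<lambda>\<omega>. X \<omega> + - (m / c)) \<in> A"
      proof
        assume "(\<lambda>\<omega>. X \<omega> + m / S0 * S1 \<omega>) \<in> A"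
        from add[OF this tU[of "- (m / c)"]] show "(\<lambda>\<omega>. X \<omega> + - (m / c)) \<in> A"
          unfolding mult_minus_left split by simp
      next
        assume "(\<lambda>\<omega>. X \<omega> + - (m / c)) \<in> A"
        from add[OF this tU[of "m / c"]] show "(\<lambda>\<omega>. X \<omega> + m / S0 * S1 \<omega>) \<in> A"
          unfolding split by simp
      qed
      also have "\<dots> \<longleftrightarrow> cash_risk_measure A X \<le> - (m / c)"
        using cash_risk_measure_le_iff[OF assms(2) X] by simp
      also have "\<dots> \<longleftrightarrow> - c * cash_risk_measure A X \<le> m"
        using c by (auto simp: field_simps)
      finally show ?thesis .
    qed
    then show "\<rho> X = - c * cash_risk_measure A X"
      by (intro order_antisym) auto
  qed
  have ab: "comonotonic M \<rho> \<longleftrightarrow> U \<in> A \<and> (\<lambda>\<omega>. - U \<omega>) \<in> A"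
    using neg_U com U by blast
  have W: "S1 \<omega> + S0 / c = S0 / c * U \<omega>" for \<omega>
    using c S0 by (simp add: U_def field_simps)
  have bc: "U \<in> A \<and> (\<lambda>\<omega>. - U \<omega>) \<in> A \<longleftrightarrow>
      (\<lambda>\<omega>. S1 \<omega> + S0 / c) \<in> A \<inter> (\<lambda>X \<omega>. - X \<omega>) ` A"
  proof
    assume nU: "U \<in> A \<and> (\<lambda>\<omega>. - U \<omega>) \<in> A"
    \<comment> \<open>As \<open>S0 / c\<close> is negative, signs swap: \<open>S0 / c * U\<close> is
      a nonnegative multiple of \<open>- U\<close>, and its negative one of
      \<open>U\<close>.\<close>
    have t: "0 \<le> - (S0 / c)" using c S0 by (simp add: divide_nonneg_neg)
    have "(\<lambda>\<omega>. S0 / c * U \<omega>) \<in> A"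
      using scale[OF conjunct2[OF nU] t] by simp
    moreover have "(\<lambda>\<omega>. S0 / c * U \<omega>) \<in> (\<lambda>X \<omega>. - X \<omega>) ` A"
      by (rule image_eqI[OF _ scale[OF U t]]) simp
    ultimately show "(\<lambda>\<omega>. S1 \<omega> + S0 / c) \<in> A \<inter> (\<lambda>X \<omega>. - X \<omega>) ` A"
      unfolding W by blast
  next
    assume "(\<lambda>\<omega>. S1 \<omega> + S0 / c) \<in> A \<inter> (\<lambda>X \<omega>. - X \<omega>) ` A"
    then have "(\<lambda>\<omega>. S0 / c * U \<omega>) \<in> A" unfolding W by blast
    \<comment> \<open>This factor turns \<open>S0 / c * U\<close> into \<open>- U\<close>.\<close>
    moreover have "0 \<le> - (c / S0)" using c S0 by (simp add: divide_nonpos_pos)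
    ultimately have "(\<lambda>\<omega>. - (c / S0) * (S0 / c * U \<omega>)) \<in> A" by (rule scale)
    then show "U \<in> A \<and> (\<lambda>\<omega>. - U \<omega>) \<in> A" using c S0 U by simp
  qed
  show ?thesis
    using ab bc unfolding U_def c_def \<rho>_def by blast
qed

end
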